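(* Let $A\in\mathbb{C}^{n\times n}$. Then the curve $\partial W(A)$ satisfies $$\det\big(p(A)\big)=0,$$ with the condition that the matrix $p(A)\ge 0$ is positive semidefinite.
   Context: The numerical range is $W(A)=\{u^\star Au/u^\star u: u\in\mathbb{C}^n\setminus\{0\}\}$, a convex set, and $\partial W(A)$ is its boundary curve. For a piecewise differentiable plane curve parameterized by arc length, $x+iy$ with $x'^2+y'^2=1$, the tangential angle $\theta$ is defined by $(x',y')=(\cos\theta,\sin\theta)$ and the pedal coordinate with respect to the origin is $p:=xy'-yx'=x\sin\theta-y\cos\theta$; $|p|$ is the distance of the origin to the tangent, and the sign of $p$ depends on the orientation of the curve. With $\operatorname{Re}A=\frac{A+A^\star}{2}$, $\operatorname{Im}A=\frac{A-A^\star}{2i}$, define $p(A):=pI-\frac{e^{i\theta}}{2i}A^\star+\frac{e^{-i\theta}}{2i}A=pI+\operatorname{Im}(e^{-i\theta}A)=pI+\cos\theta\,\operatorname{Im}A-\sin\theta\,\operatorname{Re}A$. *)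

theory Defs
  imports "HOL-Complex_Analysis.Complex_Analysis"
begin

unbundle no fps_syntax

definition hdot :: "complex ^ 'n \<Rightarrow> complex ^ 'n \<Rightarrow> complex" where
  "hdot u v = (\<Sum>i\<in>UNIV. cnj (u $ i) * v $ i)"

definition conj_transpose :: "complex ^ 'n ^ 'm \<Rightarrow> complex ^ 'm ^ 'n" where
  "conj_transpose A = (\<chi> i j. cnj (A $ j $ i))"

definition mat_scale :: "complex \<Rightarrow> complex ^ 'n ^ 'm \<Rightarrow> complex ^ 'n ^ 'm" where
  "mat_scale c A = (\<chi> i j. c * A $ i $ j)"

definition pos_semidef :: "complex ^ 'n ^ 'n \<Rightarrow> bool" where
  "pos_semidef M \<longleftrightarrow> conj_transpose M = M \<and> (\<forall>u. 0 \<le> Re (hdot u (M *v u)))"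

definition numerical_range :: "complex ^ 'n ^ 'n \<Rightarrow> complex set" where
  "numerical_range A = {hdot u (A *v u) / hdot u u | u. u \<noteq> 0}"

definition pedal_coord :: "complex \<Rightarrow> real \<Rightarrow> real" where
  "pedal_coord z \<theta> = Re z * sin \<theta> - Im z * cos \<theta>"

definition pedal_matrix :: "real \<Rightarrow> real \<Rightarrow> complex ^ 'n ^ 'n \<Rightarrow> complex ^ 'n ^ 'n" where
  "pedal_matrix p \<theta> A =
     mat (complex_of_real p)
     - mat_scale (exp (\<i> * complex_of_real \<theta>) / (2 * \<i>)) (conj_transpose A)
     + mat_scale (exp (- (\<i> * complex_of_real \<theta>)) / (2 * \<i>)) A"

definition arc_length_curve :: "real \<Rightarrow> (real \<Rightarrow> complex) \<Rightarrow> bool" where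
  "arc_length_curve L \<gamma> \<longleftrightarrow>
     0 \<le> L \<and> continuous_on {0..L} \<gamma> \<and>
     (\<exists>S. finite S \<and> (\<forall>t\<in>{0..L} - S. \<exists>v.
        (\<gamma> has_vector_derivative v) (at t within {0..L}) \<and> norm v = 1))"

text \<open>At the end points of \<open>{0..L}\<close> the derivative is one-sided. Since the base point of a
  closed curve is arbitrary, this also covers the one-sided tangents at corners. In the case
  \<open>L = 0\<close> (a single point) every angle is a tangential angle.\<close>

definition tangential_angle :: "real \<Rightarrow> (real \<Rightarrow> complex) \<Rightarrow> real \<Rightarrow> real \<Rightarrow> bool" where
  "tangential_angle L \<gamma> t \<theta> \<longleftrightarrow>
     (\<gamma> has_vector_derivative Complex (cos \<theta>) (sin \<theta>)) (at t within {0..L})"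

text \<open>The boundary of a compact convex set, traversed once counterclockwise. If the set has no
  interior, then it is a segment or a point; it is its own boundary, a simple closed
  parameterization need not exist, and there is no orientation to fix, so any closed
  arc length parameterization is admitted.\<close>

definition boundary_curve :: "complex set \<Rightarrow> real \<Rightarrow> (real \<Rightarrow> complex) \<Rightarrow> bool" where
  "boundary_curve W L \<gamma> \<longleftrightarrow>
     arc_length_curve L \<gamma> \<and> \<gamma> L = \<gamma> 0 \<and> \<gamma> ` {0..L} = frontier W \<and>
     (interior W \<noteq> {} \<longrightarrow>
        simple_path (\<lambda>s. \<gamma> (L * s)) \<and>
        (\<forall>z\<in>interior W. winding_number (\<lambda>s. \<gamma> (L * s)) z = 1))"

end

theory Submission imports Defs begin

text \<open>Writing \<open>z = \<gamma> t\<close> and \<open>w = u\<^sup>* A u / u\<^sup>* u\<close>, the quadratic form of the pedal matrix at \<open>u\<close> is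
  \<open>u\<^sup>* u\<close> times the imaginary part of \<open>exp (- i \<theta>) (w - z)\<close>. Semidefiniteness therefore says that
  the numerical range lies to the left of the tangent, and singularity follows since \<open>z\<close> itself
  belongs to the numerical range, which is compact. If \<open>w\<close> is an interior point, then the argument
  of \<open>\<gamma> - w\<close> is injective, because a ray from \<open>w\<close> meets the boundary of a convex set only once,
  and it increases by \<open>2 \<pi>\<close> in total; so it is increasing, and its derivative at \<open>t\<close> is
  nonnegative, which says that \<open>w\<close> lies to the left of the tangent. Without interior points, the
  convex numerical range lies on a line, which then is the tangent.\<close>

section \<open>The standard sesquilinear form\<close>

lemma hdot_add_left: "hdot (u + v) w = hdot u w + hdot v w"
  by (simp add: hdot_def sum.distrib algebra_simps)

lemma hdot_add_right: "hdot w (u + v) = hdot w u + hdot w v"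
  by (simp add: hdot_def sum.distrib algebra_simps)

lemma hdot_diff_right: "hdot w (u - v) = hdot w u - hdot w v"
  by (simp add: hdot_def sum_subtractf algebra_simps)

lemma hdot_scale_left: "hdot (c *s u) v = cnj c * hdot u v"
  by (simp add: hdot_def sum_distrib_left mult_ac)

lemma hdot_scale_right: "hdot u (c *s v) = c * hdot u v"
  by (simp add: hdot_def sum_distrib_left mult_ac)

lemma cnj_hdot: "cnj (hdot u v) = hdot v u"
  by (simp add: hdot_def mult.commute)

lemma hdot_self: "hdot u u = of_real ((norm u)\<^sup>2)"
  unfolding hdot_def norm_vec_def L2_set_def
  by (simp add: sum_nonneg complex_norm_square mult.commute del: of_real_power)

lemma hdot_self_eq_0_iff: "hdot u u = 0 \<longleftrightarrow> u = 0"
  by (simp add: hdot_self)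

lemma hdot_conj_transpose: "hdot u (conj_transpose A *v v) = hdot (A *v u) v"
proof -
  have "hdot u (conj_transpose A *v v) = (\<Sum>i\<in>UNIV. \<Sum>j\<in>UNIV. cnj (u $ i) * (cnj (A $ j $ i) * v $ j))"
    by (simp add: hdot_def conj_transpose_def matrix_vector_mult_def sum_distrib_left)
  also have "\<dots> = (\<Sum>j\<in>UNIV. \<Sum>i\<in>UNIV. cnj (u $ i) * (cnj (A $ j $ i) * v $ j))"
    by (rule sum.swap)
  also have "\<dots> = hdot (A *v u) v"
    by (simp add: hdot_def matrix_vector_mult_def sum_distrib_right sum_distrib_left mult_ac)
  finally show ?thesis .
qed

lemma mat_scale_mult_vec: "mat_scale c A *v u = c *s (A *v u)"
  by (simp add: mat_scale_def matrix_vector_mult_def vec_eq_iff sum_distrib_left mult_ac)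

lemma mat_mult_vec: "mat (c :: complex) *v u = c *s u"
  by (simp add: mat_def matrix_vector_mult_def vec_eq_iff if_distrib[of "\<lambda>x. x * y" for y] cong: if_cong)

text \<open>Moving from \<open>u\<close> by \<open>- s\<close> times \<open>w = M *v u\<close>
  changes the form from 0 to \<open>s\<^sup>2 * k - 2 * s * (norm w)\<^sup>2\<close>. This is
  nonnegative for all \<open>s > 0\<close>; dividing by \<open>s\<close> and letting
  \<open>s\<close> tend to 0 forces \<open>w = 0\<close>.\<close>

lemma pos_semidef_null:
  assumes "pos_semidef M" "hdot u (M *v u) = 0"
  shows "M *v u = 0"
proof -
  define w where "w = M *v u"
  define k where "k = Re (hdot w (M *v w))"
  have herm: "conj_transpose M = M" and nonneg: "0 \<le> Re (hdot v (M *v v))" for v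
    using assms(1) by (auto simp: pos_semidef_def)
  have uMw: "hdot u (M *v w) = of_real ((norm w)\<^sup>2)"
    using hdot_conj_transpose[of u M w] herm by (simp add: hdot_self w_def)
  have wMu: "hdot w (M *v u) = of_real ((norm w)\<^sup>2)"
    by (simp add: hdot_self flip: w_def)
  have "cnj (hdot w (M *v w)) = hdot w (M *v w)"
    using hdot_conj_transpose[of w M w] herm by (simp add: cnj_hdot)
  then have wMw: "hdot w (M *v w) = of_real k"
    by (simp add: k_def complex_eq_iff)
  have bound: "2 * (norm w)\<^sup>2 \<le> s * k" if "s > 0" for s :: real
  proof -
    have "hdot (u + of_real r *s w) (M *v (u + of_real r *s w))
        = of_real (2 * r * (norm w)\<^sup>2 + r\<^sup>2 * k)" for r
      using assms(2) wMw
      by (simp add: matrix_vector_right_distrib vec.scale hdot_add_left hdot_add_right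
          hdot_scale_left hdot_scale_right uMw wMu power2_eq_square algebra_simps)
    from this[of "- s"] nonneg[of "u + of_real (- s) *s w"]
    have "0 \<le> - 2 * s * (norm w)\<^sup>2 + s\<^sup>2 * k"
      by (simp only: Re_complex_of_real) simp
    then have "0 \<le> s * (s * k - 2 * (norm w)\<^sup>2)"
      by (simp add: power2_eq_square algebra_simps)
    then show ?thesis
      using that by (simp add: zero_le_mult_iff)
  qed
  have "2 * (norm w)\<^sup>2 \<le> 0"
  proof (rule tendsto_le[OF trivial_limit_at_right_real])
    show "((\<lambda>s. s * k) \<longlongrightarrow> 0) (at_right (0 :: real))"
      by (auto intro!: tendsto_eq_intros)
    show "((\<lambda>s. 2 * (norm w)\<^sup>2) \<longlongrightarrow> 2 * (norm w)\<^sup>2) (at_right (0 :: real))"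
      by simp
    show "\<forall>\<^sub>F s in at_right 0. 2 * (norm w)\<^sup>2 \<le> s * k"
      using bound by (auto simp: eventually_at_filter)
  qed
  then show ?thesis
    by (simp add: w_def)
qed

lemma det_eq_0_if_kernel:
  fixes M :: "'a :: field ^ 'n ^ 'n"
  assumes "M *v u = 0" "u \<noteq> 0"
  shows "det M = 0"
  using assms matrix_left_invertible_ker[of M] invertible_det_nz[of M]
  unfolding invertible_def by blast

section \<open>The numerical range\<close>

lemma continuous_on_quadratic_form: "continuous_on S (\<lambda>u. hdot u (A *v u))"
  unfolding hdot_def matrix_vector_mult_def by (auto intro!: continuous_intros)

lemma Rayleigh_quotient_scale:
  assumes "c \<noteq> 0"
  shows "hdot (c *s u) (A *v (c *s u)) / hdot (c *s u) (c *s u) = hdot u (A *v u) / hdot u u"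
  using assms by (simp add: vec.scale hdot_scale_left hdot_scale_right)

text \<open>Rayleigh quotients are invariant under scaling, so unit vectors suffice. This form
  yields compactness, and later a unit vector attaining \<open>\<gamma> t\<close>.\<close>

lemma numerical_range_eq_image_sphere:
  "numerical_range A = (\<lambda>u. hdot u (A *v u)) ` sphere 0 1"
proof (intro equalityI subsetI)
  fix z assume "z \<in> numerical_range A"
  then obtain u where u: "u \<noteq> 0" "z = hdot u (A *v u) / hdot u u"
    by (auto simp: numerical_range_def)
  define v where "v = complex_of_real (1 / norm u) *s u"
  have "hdot v v = 1"
    using u(1) unfolding v_def hdot_scale_left hdot_scale_right
    by (simp add: hdot_self power2_eq_square)
  then have "complex_of_real ((norm v)\<^sup>2) = of_real 1"
    by (simp add: hdot_self)
  then have "(norm v)\<^sup>2 = 1"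
    by (simp only: of_real_eq_iff)
  then have "v \<in> sphere 0 1"
    by (simp add: power2_eq_1_iff) (metis norm_ge_zero not_one_le_zero neg_0_le_iff_le)
  moreover have "z = hdot v (A *v v)"
    using Rayleigh_quotient_scale[of "complex_of_real (1 / norm u)" u A] u \<open>hdot v v = 1\<close>
    by (simp add: v_def)
  ultimately show "z \<in> (\<lambda>u. hdot u (A *v u)) ` sphere 0 1"
    by blast
next
  fix z assume "z \<in> (\<lambda>u. hdot u (A *v u)) ` sphere 0 1"
  then obtain u where "norm u = 1" "z = hdot u (A *v u)"
    by auto
  then have "u \<noteq> 0" "z = hdot u (A *v u) / hdot u u"
    by (auto simp: hdot_self)
  then show "z \<in> numerical_range A"
    by (auto simp: numerical_range_def)
qed

lemma compact_numerical_range: "compact (numerical_range A)"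
  unfolding numerical_range_eq_image_sphere
  by (intro compact_continuous_image continuous_on_quadratic_form compact_sphere)

lemma ex_unit_rotation_real: "\<exists>c. norm c = 1 \<and> Im (c * w) = 0" for w :: complex
proof (cases "w = 0")
  case False
  then show ?thesis
    by (intro exI[of _ "cnj (sgn w)"])
      (simp add: norm_divide sgn_eq flip: of_real_mult complex_norm_square)
qed (auto intro: exI[of _ 1])

text \<open>After an affine change, the endpoints of the segment are \<open>0\<close> and \<open>1\<close>; after a rotation of
  \<open>u\<close>, the quadratic form is real along the line from \<open>u\<close> to \<open>v\<close>, and the intermediate value
  theorem applies.\<close>

lemma convex_numerical_range: "convex (numerical_range A)"
  unfolding convex_alt
proof (intro ballI allI impI, elim conjE)
  fix a b and r :: real
  assume ab: "a \<in> numerical_range A" "b \<in> numerical_range A" and r: "0 \<le> r" "r \<le> 1"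
  show "(1 - r) *\<^sub>R a + r *\<^sub>R b \<in> numerical_range A"
  proof (cases "a = b")
    case True
    then show ?thesis
      using ab by (simp add: algebra_simps)
  next
    case False
    obtain u0 where u0: "u0 \<noteq> 0" "a = hdot u0 (A *v u0) / hdot u0 u0"
      using ab by (auto simp: numerical_range_def)
    obtain v where v: "v \<noteq> 0" "b = hdot v (A *v v) / hdot v v"
      using ab by (auto simp: numerical_range_def)
    \<comment> \<open>The sesquilinear form of \<open>(A - a I) / (b - a)\<close>: its Rayleigh
      quotients are those of \<open>A\<close> after the affine map sending \<open>a\<close> to 0 and
      \<open>b\<close> to 1.\<close>
    define h where "h x y = (hdot x (A *v y) - a * hdot x y) / (b - a)" for x y
    \<comment> \<open>For \<open>u = c *s u0\<close> the imaginary part of the cross term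
      \<open>h u v + h v u\<close> is exactly this one, since conjugating
      \<open>cnj c * h u0 v\<close> flips the sign of its imaginary part.\<close>
    obtain c where c: "norm c = 1" "Im (c * (h v u0 - cnj (h u0 v))) = 0"
      using ex_unit_rotation_real by blast
    define u where "u = c *s u0"
    have "c \<noteq> 0"
      using c by auto
    then have u: "u \<noteq> 0" "a = hdot u (A *v u) / hdot u u"
      using u0 Rayleigh_quotient_scale[of c u0 A] by (auto simp: u_def)
    have h_add: "h (x + x') y = h x y + h x' y" "h x (y + y') = h x y + h x y'" for x x' y y'
      using False by (simp_all add: h_def matrix_vector_right_distrib hdot_add_left hdot_add_right
          algebra_simps flip: add_divide_distrib)
    have h_scale: "h (k *s x) y = cnj k * h x y" "h x (k *s y) = k * h x y" for k x y
      using False by (simp_all add: h_def vec.scale hdot_scale_left hdot_scale_right algebra_simps)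
    have huu: "h u u = 0"
      using u by (simp add: h_def hdot_self_eq_0_iff)
    have hvv: "h v v = hdot v v"
      using v False by (simp add: h_def hdot_self_eq_0_iff field_simps)
    define x where "x s = complex_of_real (1 - s) *s u + complex_of_real s *s v" for s :: real
    \<comment> \<open>Otherwise a nonzero multiple of \<open>v\<close> is a multiple of
      \<open>u\<close>, where \<open>h\<close> vanishes; but \<open>h v v = hdot v v\<close> is
      nonzero.\<close>
    have x_nonzero: "x s \<noteq> 0" for s
    proof
      assume "x s = 0"
      show False
      proof (cases "s = 0")
        case True
        then show ?thesis
          using \<open>x s = 0\<close> u by (simp add: x_def)
      next
        case s: False
        have "complex_of_real s *s v = complex_of_real (- (1 - s)) *s u"
          using \<open>x s = 0\<close> by (simp add: x_def eq_neg_iff_add_eq_0 add.commute vec_eq_iff algebra_simps)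
        then have "h (complex_of_real s *s v) (complex_of_real s *s v) = 0"
          using huu by (simp only: h_scale mult_zero_right)
        then show False
          using s v by (simp add: h_scale hvv hdot_self_eq_0_iff)
      qed
    qed
    have Im_h: "Im (h (x s) (x s)) = 0" for s
    proof -
      have "Im (h u v + h v u) = Im (c * (h v u0 - cnj (h u0 v)))"
        by (simp add: u_def h_scale algebra_simps)
      then have "Im (h u v + h v u) = 0"
        using c by simp
      moreover have "h (x s) (x s)
          = of_real (s\<^sup>2) * h v v + of_real (s * (1 - s)) * (h u v + h v u)"
        unfolding x_def h_add h_scale huu by (simp add: power2_eq_square algebra_simps)
      ultimately show ?thesis
        by (simp add: hvv hdot_self)
    qed
    define g where "g s = Re (h (x s) (x s)) / (norm (x s))\<^sup>2" for s
    have "continuous_on {0..1} x"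
      unfolding x_def vector_scalar_mult_def by (intro continuous_intros)
    then have "continuous_on {0..1} g"
      unfolding g_def h_def hdot_def matrix_vector_mult_def
      using x_nonzero False by (auto intro!: continuous_intros)
    moreover have "g 0 = 0" "g 1 = 1"
      using v by (simp_all add: g_def x_def huu hvv hdot_self)
    ultimately obtain s where "g s = r"
      using IVT'[of g 0 r 1] r by auto
    then have "Re (h (x s) (x s)) = r * (norm (x s))\<^sup>2"
      using x_nonzero[of s] by (simp add: g_def field_simps)
    then have "h (x s) (x s) = of_real r * hdot (x s) (x s)"
      using Im_h[of s] by (simp add: complex_eq_iff hdot_self)
    then have "hdot (x s) (A *v x s) = (a + of_real r * (b - a)) * hdot (x s) (x s)"
      using False by (simp add: h_def field_simps)
    then have "hdot (x s) (A *v x s) / hdot (x s) (x s) = (1 - r) *\<^sub>R a + r *\<^sub>R b"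
      using x_nonzero[of s] by (simp add: hdot_self_eq_0_iff) (simp add: scaleR_conv_of_real algebra_simps)
    then show ?thesis
      using x_nonzero[of s] unfolding numerical_range_def by (metis (mono_tags, lifting) mem_Collect_eq)
  qed
qed

section \<open>The tangents of a convex boundary curve\<close>

text \<open>The nearer of two distinct points on a ray from \<open>w\<close> would lie in the open
  segment from the interior point \<open>w\<close> to a closure point, hence in the interior.
  Exchanging the points replaces \<open>r\<close> by \<open>1 / r\<close>, so only
  \<open>r = 1\<close> remains.\<close>

lemma frontier_convex_ray_unique:
  fixes W :: "'a :: euclidean_space set"
  assumes W: "convex W" "w \<in> interior W" and ab: "a \<in> frontier W" "b \<in> frontier W"
    and ray: "a - w = r *\<^sub>R (b - w)" "r > 0"
  shows "a = b"
proof -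
  have *: "\<not> s < 1" if "x \<in> frontier W" "y \<in> frontier W" "x - w = s *\<^sub>R (y - w)" "s > 0" for x y s
  proof
    assume "s < 1"
    have "y \<noteq> w"
      using that W by (auto simp: frontier_def)
    moreover have "x = (1 - s) *\<^sub>R w + s *\<^sub>R y"
      using that by (simp add: algebra_simps)
    ultimately have "x \<in> open_segment w y"
      using \<open>s < 1\<close> that by (auto simp: in_segment)
    then show False
      using in_interior_closure_convex_segment[OF W, of y] that by (auto simp: frontier_def)
  qed
  have "b - w = (1 / r) *\<^sub>R (a - w)"
    using ray by simp
  then have "r = 1"
    using *[of a b r] *[of b a "1 / r"] ab ray by (auto simp: field_simps)
  then show ?thesis
    using ray by simp
qed

lemma interior_left_of_tangent:
  assumes W: "convex W" "w \<in> interior W" and curve: "boundary_curve W L \<gamma>"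
    and t: "t \<in> {0..L}" and tangent: "tangential_angle L \<gamma> t \<theta>"
  shows "0 \<le> Im (cis (- \<theta>) * (w - \<gamma> t))"
proof -
  define p where "p s = \<gamma> (L * s)" for s
  have simple: "simple_path p" and wn: "winding_number p w = 1"
    and img: "\<gamma> ` {0..L} = frontier W" and L0: "0 \<le> L"
    using curve W unfolding p_def[abs_def] boundary_curve_def arc_length_curve_def by auto
  have "L \<noteq> 0"
  proof
    assume "L = 0"
    then have "p 0 = p (1 / 2)"
      by (simp add: p_def)
    have "p x \<noteq> p y" if "x \<in> {0..1}" "y \<in> {0..1}" "x < y" "y < 1" for x y
      using that simple by (force simp: simple_path_def loop_free_def)
    from this[of 0 "1 / 2"] \<open>p 0 = p (1 / 2)\<close> show False
      by simp
  qed
  then have L: "L > 0"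
    using L0 by simp
  have p_frontier: "p s \<in> frontier W" if "s \<in> {0..1}" for s
    using that L img by (force simp: p_def mult_le_cancel_left1)
  then have "w \<notin> path_image p"
    using W by (auto simp: path_image_def frontier_def)
  \<comment> \<open>A continuous logarithm of \<open>p - w\<close>. Its imaginary part
    \<open>f\<close> is a continuous argument, and winding number 1 makes it grow by
    \<open>2 * pi\<close>.\<close>
  then obtain q where q: "path q" "pathfinish q - pathstart q = 2 * of_real pi * \<i> * winding_number p w"
      "\<And>s. s \<in> {0..1} \<Longrightarrow> p s = w + exp (q s)"
    using winding_number_as_continuous_log[of p w] simple simple_path_imp_path by metis
  define f where "f s = Im (q s)" for s
  have f01: "f 1 = f 0 + 2 * pi"
    using q(2) by (simp add: wn f_def pathfinish_def pathstart_def complex_eq_iff)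
  have cont_f: "continuous_on {0..1} f"
    using q(1) unfolding f_def path_def by (intro continuous_intros)
  have ray: "p s - w = exp (Re (q s) - Re (q s')) *\<^sub>R (p s' - w)"
    if "f s = f s'" "s \<in> {0..1}" "s' \<in> {0..1}" for s s'
  proof -
    have "q s = of_real (Re (q s) - Re (q s')) + q s'"
      using that(1) by (simp add: f_def complex_eq_iff)
    then have "exp (q s) = of_real (exp (Re (q s) - Re (q s'))) * exp (q s')"
      by (metis exp_add exp_of_real)
    then show ?thesis
      using q(3)[OF that(2)] q(3)[OF that(3)] by (simp only: scaleR_conv_of_real add_diff_cancel_left')
  qed
  have "inj_on f {0..1}"
  proof (rule inj_onI)
    fix s s' assume s: "s \<in> {0..1}" "s' \<in> {0..1}" "f s = f s'"
    then have "p s = p s'"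
      using frontier_convex_ray_unique[OF W p_frontier[OF s(1)] p_frontier[OF s(2)]
          \<comment> \<open>Equal arguments put both points on one ray from \<open>w\<close>. The
            simple path then allows only coincidence of the two end points, which the increment of
            \<open>f\<close> excludes.\<close>
          ray[OF s(3) s(1,2)]] by simp
    then have "s = s' \<or> s = 0 \<and> s' = 1 \<or> s = 1 \<and> s' = 0"
      using simple s by (auto simp: simple_path_def loop_free_def)
    then show "s = s'"
      using s f01 by auto
  qed
  then have "strict_mono_on {0..1} f \<or> strict_antimono_on {0..1} f"
    using injective_eq_monotone_map[of "{0..1}" f] cont_f by (simp add: is_interval_cc)
  moreover have "\<not> strict_antimono_on {0..1} f"
  proof
    assume "strict_antimono_on {0..1} f"
    then have "f 1 < f 0"
      by (rule monotone_onD) auto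
    then show False
      using f01 by simp
  qed
  ultimately have mono: "f s < f s'" if "s \<in> {0..1}" "s' \<in> {0..1}" "s < s'" for s s'
    using that by (auto simp: strict_mono_on_def)

  define d where "d = Complex (cos \<theta>) (sin \<theta>)"
  define e where "e = \<gamma> t - w"
  have "\<gamma> t \<in> frontier W"
    using t img by auto
  then have "e \<noteq> 0"
    using W by (auto simp: e_def frontier_def)
  \<comment> \<open>Dividing by \<open>e\<close> measures angles from the direction of
    \<open>\<gamma> t\<close>, so near \<open>t\<close> the sign of \<open>g\<close> is that of the
    change of argument. Unlike \<open>f\<close>, it inherits its derivative at \<open>t\<close>
    directly from \<open>\<gamma>\<close>.\<close>
  define g where "g s = Im ((\<gamma> s - w) / e)" for s
  have in01: "s / L \<in> {0..1}" if "s \<in> {0..L}" for s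
    using that L by auto
  have polar: "(\<gamma> s - w) / e = of_real (exp (Re (q (s / L)) - Re (q (t / L))))
      * cis (f (s / L) - f (t / L))" if "s \<in> {0..L}" for s
  proof -
    have "\<gamma> s = w + exp (q (s / L))" "\<gamma> t = w + exp (q (t / L))"
      using q(3) in01[OF that] in01[OF t] L by (force simp: p_def)+
    then have "(\<gamma> s - w) / e = exp (q (s / L) - q (t / L))"
      by (simp add: e_def exp_diff)
    then show ?thesis
      by (simp add: exp_eq_polar f_def)
  qed
  have gt: "g t = 0"
    using \<open>e \<noteq> 0\<close> by (simp add: g_def e_def)
  have "(g has_vector_derivative Im (d / e)) (at t within {0..L})"
    unfolding g_def
    using tangent unfolding tangential_angle_def d_def
    by (auto intro!: bounded_linear.has_vector_derivative[OF bounded_linear_Im]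
        bounded_linear.has_vector_derivative[OF bounded_linear_divide] derivative_eq_intros)
  then have lim: "((\<lambda>s. (g s - g t) / (s - t)) \<longlongrightarrow> Im (d / e)) (at t within {0..L})"
    by (simp add: has_real_derivative_iff_has_vector_derivative[symmetric] has_field_derivative_iff)
  have "continuous_on {0..L} (\<lambda>s. f (s / L))"
    by (rule continuous_on_compose2[OF cont_f]) (use in01 L in \<open>auto intro!: continuous_intros\<close>)
  then have "((\<lambda>s. f (s / L)) \<longlongrightarrow> f (t / L)) (at t within {0..L})"
    using t by (auto simp: continuous_on_def)
  \<comment> \<open>Within distance \<open>pi\<close> the sine has the sign of its argument, so
    monotonicity of \<open>f\<close> fixes the sign of \<open>g\<close>.\<close>
  then have "\<forall>\<^sub>F s in at t within {0..L}. dist (f (s / L)) (f (t / L)) < pi"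
    by (rule tendstoD) simp
  moreover have "\<forall>\<^sub>F s in at t within {0..L}. s \<in> {0..L} \<and> s \<noteq> t"
    by (simp add: eventually_at_filter)
  ultimately have ev: "\<forall>\<^sub>F s in at t within {0..L}. 0 \<le> (g s - g t) / (s - t)"
  proof eventually_elim
    case (elim s)
    then have s: "s \<in> {0..L}" "s \<noteq> t" and near: "\<bar>f (s / L) - f (t / L)\<bar> < pi"
      by (auto simp: dist_real_def)
    have g: "g s = exp (Re (q (s / L)) - Re (q (t / L))) * sin (f (s / L) - f (t / L))"
      using polar[OF s(1)] by (simp add: g_def)
    show ?case
    proof (cases "s < t")
      case True
      then have "f (s / L) < f (t / L)"
        using mono[OF in01[OF s(1)] in01[OF t]] L by (simp add: divide_strict_right_mono)
      then have "0 \<le> sin (f (t / L) - f (s / L))"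
        using near by (intro sin_ge_zero) auto
      then have "g s \<le> 0"
        unfolding g using sin_minus[of "f (s / L) - f (t / L)"] by (intro mult_nonneg_nonpos) auto
      then show ?thesis
        using True gt by (simp add: divide_nonpos_neg)
    next
      case False
      then have "f (t / L) < f (s / L)"
        using mono[OF in01[OF t] in01[OF s(1)]] L s by (simp add: divide_strict_right_mono)
      then have "0 \<le> sin (f (s / L) - f (t / L))"
        using near by (intro sin_ge_zero) auto
      then have "0 \<le> g s"
        unfolding g by simp
      then show ?thesis
        using False s gt by simp
    qed
  qed
  have "at t within {0..L} \<noteq> bot"
    using t L by (simp add: trivial_limit_within islimpt_Icc)
  then have "0 \<le> Im (d / e)"
    using tendsto_lowerbound[OF lim ev] by blast
  moreover have "Im (d / e) = Im (cnj d * (w - \<gamma> t)) / (norm e)\<^sup>2"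
    by (simp add: Im_divide cmod_power2 e_def algebra_simps)
  moreover have "cnj d = cis (- \<theta>)"
    by (simp add: d_def complex_eq_iff)
  ultimately show ?thesis
    using \<open>e \<noteq> 0\<close> by (simp add: zero_le_divide_iff)
qed

text \<open>With interior points, the closed half-plane left of the tangent contains the closure of
  the interior, which includes \<open>W\<close>. Otherwise \<open>W\<close> lies on a line, the
  curve stays on it, and the tangent direction is that of the line.\<close>

lemma left_of_tangent:
  assumes W: "compact W" "convex W" "w \<in> W" and curve: "boundary_curve W L \<gamma>"
    and t: "t \<in> {0..L}" and tangent: "tangential_angle L \<gamma> t \<theta>"
  shows "0 \<le> Im (cis (- \<theta>) * (w - \<gamma> t))"
proof (cases "interior W = {}")
  case False
  have "closed {w. 0 \<le> Im (cis (- \<theta>) * (w - \<gamma> t))}"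
    by (intro closed_Collect_le continuous_intros)
  then have "closure (interior W) \<subseteq> {w. 0 \<le> Im (cis (- \<theta>) * (w - \<gamma> t))}"
    using interior_left_of_tangent[OF W(2) _ curve t tangent] by (intro closure_minimal) auto
  moreover have "w \<in> closure (interior W)"
    using convex_closure_interior[OF W(2) False] W closure_subset by auto
  ultimately show ?thesis
    by blast
next
  case True
  have img: "\<gamma> ` {0..L} = W" and L0: "0 \<le> L"
    using curve True W compact_imp_closed[of W]
    by (auto simp: boundary_curve_def arc_length_curve_def frontier_def closure_closed)
  show ?thesis
  proof (cases "L = 0")
    case True
    then show ?thesis
      using img t W by auto
  next
    case False
    then have L: "L > 0"
      using L0 by simp
    obtain a b where a: "a \<noteq> 0" "W \<subseteq> {x. a \<bullet> x = b}"
      using empty_interior_subset_hyperplane[OF W(2) True] by blast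
    define d where "d = Complex (cos \<theta>) (sin \<theta>)"
    have on_line: "a \<bullet> \<gamma> s = b" if "s \<in> {0..L}" for s
      using that a img by blast
    have "((\<lambda>s. a \<bullet> \<gamma> s) has_vector_derivative a \<bullet> d) (at t within {0..L})"
      using tangent unfolding tangential_angle_def d_def
      by (rule bounded_linear.has_vector_derivative[OF bounded_linear_inner_right])
    moreover have "((\<lambda>s. a \<bullet> \<gamma> s) has_vector_derivative 0) (at t within {0..L})"
      by (rule has_vector_derivative_transform[OF t _ has_vector_derivative_const[of b]])
        (use on_line in auto)
    ultimately have "a \<bullet> d = 0"
      using vector_derivative_unique_within[of t "{0..L}"] t L
      by (metis trivial_limit_within islimpt_Icc)
    moreover have "a \<bullet> (w - \<gamma> t) = 0"
      using on_line[OF t] a W by (auto simp: inner_diff_right)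
    \<comment> \<open>The imaginary part is the determinant of \<open>d\<close> and
      \<open>w - \<gamma> t\<close>. Both are orthogonal to \<open>a\<close>, so each coordinate of
      \<open>a\<close> times the determinant vanishes.\<close>
    ultimately have "Re a * Im (cis (- \<theta>) * (w - \<gamma> t)) = 0"
      "Im a * Im (cis (- \<theta>) * (w - \<gamma> t)) = 0"
      by (simp_all add: d_def inner_complex_def, algebra+)
    then have "Im (cis (- \<theta>) * (w - \<gamma> t)) = 0"
      using a(1) by (metis complex_eq_iff mult_eq_0_iff zero_complex.sel)
    then show ?thesis
      by simp
  qed
qed

section \<open>The pedal matrix\<close>

lemma conj_transpose_pedal_matrix:
  "conj_transpose (pedal_matrix p \<theta> A) = pedal_matrix p \<theta> A"
  by (simp add: pedal_matrix_def conj_transpose_def mat_scale_def mat_def vec_eq_iff exp_cnj)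

text \<open>The matrix is \<open>p\<close> times the identity plus the Hermitian imaginary part of
  \<open>cis (- \<theta>)\<close> times \<open>A\<close>, and the form of a Hermitian imaginary part
  is the imaginary part of the form.\<close>

lemma pedal_matrix_quadratic_form:
  "hdot u (pedal_matrix p \<theta> A *v u)
    = of_real (p * (norm u)\<^sup>2 + Im (cis (- \<theta>) * hdot u (A *v u)))"
proof -
  define z where "z = hdot u (A *v u)"
  have cz: "hdot u (conj_transpose A *v u) = cnj z"
    by (simp add: z_def hdot_conj_transpose cnj_hdot)
  have "hdot u (pedal_matrix p \<theta> A *v u) = of_real (p * (norm u)\<^sup>2)
      + (cis (- \<theta>) * z - cnj (cis (- \<theta>) * z)) / (2 * \<i>)"
    by (simp add: pedal_matrix_def matrix_vector_mult_add_rdistrib matrix_vector_mult_diff_rdistrib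
        mat_scale_mult_vec mat_mult_vec hdot_add_right hdot_diff_right hdot_scale_right cz
        hdot_self cis_cnj flip: z_def cis_conv_exp)
      (simp add: cis_conv_exp field_simps)
  also have "(y - cnj y) / (2 * \<i>) = of_real (Im y)" for y
    by (simp add: complex_diff_cnj mult.commute[of _ \<i>] flip: mult.assoc)
  finally show ?thesis
    by (simp add: z_def)
qed

theorem proposition39:
  fixes A :: "complex ^ 'n ^ 'n"
    and \<gamma> :: "real \<Rightarrow> complex"
    and L t \<theta> :: real
  assumes "boundary_curve (numerical_range A) L \<gamma>"
    and "t \<in> {0..L}"
    and "tangential_angle L \<gamma> t \<theta>"
  shows "det (pedal_matrix (pedal_coord (\<gamma> t) \<theta>) \<theta> A) = 0 \<and>
         pos_semidef (pedal_matrix (pedal_coord (\<gamma> t) \<theta>) \<theta> A)"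
proof -
  define M where "M = pedal_matrix (pedal_coord (\<gamma> t) \<theta>) \<theta> A"
  \<comment> \<open>The pedal coordinate equals \<open>- Im (cis (- \<theta>) * \<gamma> t)\<close>,
    so adding it shifts the origin to \<open>\<gamma> t\<close>.\<close>
  have form: "hdot u (M *v u) = of_real ((norm u)\<^sup>2 * Im (cis (- \<theta>) * (w - \<gamma> t)))"
    if "hdot u (A *v u) = of_real ((norm u)\<^sup>2) * w" for u w
    by (simp add: M_def pedal_matrix_quadratic_form pedal_coord_def that algebra_simps)
  have "0 \<le> Re (hdot u (M *v u))" for u
  proof (cases "u = 0")
    case False
    define w where "w = hdot u (A *v u) / hdot u u"
    have "w \<in> numerical_range A"
      using False by (auto simp: w_def numerical_range_def)
    then have "0 \<le> Im (cis (- \<theta>) * (w - \<gamma> t))"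
      using left_of_tangent[OF compact_numerical_range convex_numerical_range _ assms] by blast
    moreover have "hdot u (A *v u) = of_real ((norm u)\<^sup>2) * w"
      using False by (simp add: w_def hdot_self)
    ultimately show ?thesis
      using form[of u w] by (simp only: Re_complex_of_real) simp
  qed (simp add: hdot_def)
  then have psd: "pos_semidef M"
    by (simp add: pos_semidef_def M_def conj_transpose_pedal_matrix)
  \<comment> \<open>A unit vector attaining \<open>\<gamma> t\<close> makes the form vanish, and
    semidefiniteness turns this into a kernel vector.\<close>
  have "\<gamma> t \<in> numerical_range A"
    using assms(1,2) frontier_subset_compact[OF compact_numerical_range[of A]]
    by (auto simp: boundary_curve_def)
  then obtain u where u: "norm u = 1" "\<gamma> t = hdot u (A *v u)"
    by (auto simp: numerical_range_eq_image_sphere)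
  then have "M *v u = 0"
    using pos_semidef_null[OF psd] form[of u "\<gamma> t"] by simp
  then have "det M = 0"
    using det_eq_0_if_kernel[of M u] u(1) by force
  then show ?thesis
    using psd by (simp add: M_def)
qed

end
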